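(* Let $\alpha\in\mathbb{R}\setminus\mathbb{Q}$, and for $N\in\mathbb{N}$ let $K=K(N,\alpha)$ denote the largest integer satisfying $q_K\le N$. Then, for all sufficiently large $N$, $$\max\Big\{\tfrac12(\log N)^2,\ A_{K+1}\Big\}\ \le\ S_N(\alpha,0)\ \le\ 33(\log N)^2+10A_{K+1}.$$
   Context: $\|x\|$ denotes the distance from $x\in\mathbb{R}$ to the nearest integer. $S_N(\alpha,0):=\sum_{n=1}^N\frac{1}{n\|n\alpha\|}$. The irrational $\alpha$ has simple continued fraction expansion $[a_0;a_1,a_2,\dots]$ with partial quotients $a_k=a_k(\alpha)$; $q_k=q_k(\alpha)$ ($k\ge 0$) are the denominators of the principal convergents $p_k/q_k=[a_0;a_1,\dots,a_k]$ in lowest terms (so $q_0=1$, $q_1=a_1$, $q_{k+1}=a_{k+1}q_k+q_{k-1}$). For $k\in\mathbb{N}$, $A_k=A_k(\alpha):=\sum_{i=1}^k a_i$. *)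

theory Defs
  imports Complex_Main
begin

definition dist_int :: "real \<Rightarrow> real" where
  "dist_int x = \<bar>x - of_int (round x)\<bar>"

text \<open>The homogeneous sum \<open>S\<^sub>N(\<alpha>, 0)\<close>.\<close>

definition S :: "nat \<Rightarrow> real \<Rightarrow> real" where
  "S N \<alpha> = (\<Sum>n=1..N. 1 / (real n * dist_int (real n * \<alpha>)))"

text \<open>
  Partial quotients come from iterating the Gauss map.  The complete quotients
  \<open>cf_cq \<alpha> k\<close> of an irrational \<open>\<alpha>\<close> are irrational, so the division is never by zero.
\<close>

primrec cf_cq :: "real \<Rightarrow> nat \<Rightarrow> real" where
  "cf_cq \<alpha> 0 = \<alpha>"
| "cf_cq \<alpha> (Suc k) = 1 / frac (cf_cq \<alpha> k)"

definition cf_a :: "real \<Rightarrow> nat \<Rightarrow> int" where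
  "cf_a \<alpha> k = \<lfloor>cf_cq \<alpha> k\<rfloor>"

fun cf_val :: "int list \<Rightarrow> rat" where
  "cf_val [] = 0"
| "cf_val [a] = of_int a"
| "cf_val (a # b # as) = of_int a + 1 / cf_val (b # as)"

definition cf_conv :: "real \<Rightarrow> nat \<Rightarrow> rat" where
  "cf_conv \<alpha> k = cf_val (map (cf_a \<alpha>) [0..<Suc k])"

text \<open>\<^const>\<open>quotient_of\<close> yields the fraction in lowest terms with positive denominator.\<close>

definition cf_q :: "real \<Rightarrow> nat \<Rightarrow> int" where
  "cf_q \<alpha> k = snd (quotient_of (cf_conv \<alpha> k))"

definition cf_A :: "real \<Rightarrow> nat \<Rightarrow> int" where
  "cf_A \<alpha> k = (\<Sum>i=1..k. cf_a \<alpha> i)"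

text \<open>
  Since \<open>q\<^sub>0 = q\<^sub>1\<close> when \<open>a\<^sub>1 = 1\<close>, it matters that the largest such index is taken.
  For irrational \<open>\<alpha>\<close> and \<open>N \<ge> 1\<close> it exists (lemma \<open>cf_K\<close> below).
\<close>

definition cf_K :: "nat \<Rightarrow> real \<Rightarrow> nat" where
  "cf_K N \<alpha> = (GREATEST k. cf_q \<alpha> k \<le> int N)"

text \<open>
  The remaining lemmas confirm the standard recurrence for the denominators and
  that \<^const>\<open>cf_K\<close> is well defined.
\<close>

lemma cf_cq_irrational: "\<alpha> \<notin> \<rat> \<Longrightarrow> cf_cq \<alpha> k \<notin> \<rat>"
proof (induction k)
  case (Suc k)
  show ?case
  proof
    assume "cf_cq \<alpha> (Suc k) \<in> \<rat>"
    from Rats_divide[OF Rats_1 this] have "frac (cf_cq \<alpha> k) \<in> \<rat>" by simp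
    then have "frac (cf_cq \<alpha> k) + of_int \<lfloor>cf_cq \<alpha> k\<rfloor> \<in> \<rat>" by (intro Rats_add) auto
    then show False using Suc by (simp add: frac_def)
  qed
qed simp

lemma cf_a_pos:
  assumes "\<alpha> \<notin> \<rat>"
  shows "cf_a \<alpha> (Suc k) \<ge> 1"
proof -
  have "cf_cq \<alpha> k \<notin> \<int>" using cf_cq_irrational[OF assms] Ints_subset_Rats by blast
  then have "frac (cf_cq \<alpha> k) > 0" by simp
  moreover have "frac (cf_cq \<alpha> k) < 1" by (rule frac_lt_1)
  ultimately have "1 / frac (cf_cq \<alpha> k) \<ge> 1" by simp
  then show ?thesis by (simp add: cf_a_def le_floor_iff)
qed

text \<open>
  \<open>ctnt 1 0 a\<close> and \<open>ctnt (a 0) 1 a\<close> are the denominators and numerators of the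
  convergents of \<open>[a 0; a 1, \<dots>]\<close>; used only in the proofs below.
\<close>

fun ctnt :: "int \<Rightarrow> int \<Rightarrow> (nat \<Rightarrow> int) \<Rightarrow> nat \<Rightarrow> int" where
  "ctnt x y a 0 = x"
| "ctnt x y a (Suc 0) = a 1 * x + y"
| "ctnt x y a (Suc (Suc k)) = a (Suc (Suc k)) * ctnt x y a (Suc k) + ctnt x y a k"

lemma ctnt_shift:
  "ctnt x y a (Suc k) = ctnt (a 1 * x + y) x (\<lambda>i. a (Suc i)) k"
  by (induction k rule: induct_nat_012) simp_all

lemma ctnt_pos:
  assumes "\<And>i. a (Suc i) \<ge> 1"
  shows "ctnt 1 0 a k \<ge> 1 \<and> ctnt 1 0 a k \<le> ctnt 1 0 a (Suc k)"
proof (induction k)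
  case 0
  then show ?case using assms[of 0] by simp
next
  case (Suc k)
  have "1 * ctnt 1 0 a (Suc k) \<le> a (Suc (Suc k)) * ctnt 1 0 a (Suc k)"
    using Suc assms[of "Suc k"] by (intro mult_right_mono) auto
  then have "ctnt 1 0 a (Suc k) \<le> a (Suc (Suc k)) * ctnt 1 0 a (Suc k) + ctnt 1 0 a k"
    using Suc by linarith
  then show ?case using Suc by simp
qed

lemma ctnt_linear: "ctnt x y a k = x * ctnt 1 0 a k + y * ctnt 0 1 a k"
  by (induction k rule: induct_nat_012) (simp_all add: algebra_simps)

lemma ctnt_det:
  "ctnt c 1 a (Suc k) * ctnt 1 0 a k - ctnt c 1 a k * ctnt 1 0 a (Suc k) = (-1) ^ k"
  by (induction k) (simp_all add: algebra_simps)

lemma ctnt_coprime: "coprime (ctnt c 1 a k) (ctnt 1 0 a k)"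
proof (rule coprimeI)
  fix d assume d: "d dvd ctnt c 1 a k" "d dvd ctnt 1 0 a k"
  have "d dvd ctnt c 1 a (Suc k) * ctnt 1 0 a k - ctnt c 1 a k * ctnt 1 0 a (Suc k)"
    using d by (intro dvd_diff) auto
  then have "d dvd (-1) ^ k" by (simp only: ctnt_det)
  then show "is_unit d" by (metis dvd_trans is_unit_power_iff dvd_minus_iff dvd_refl)
qed

lemma cf_val_ctnt:
  assumes "\<And>i. a (Suc i) \<ge> 1"
  shows "cf_val (map a [0..<Suc k]) = of_int (ctnt (a 0) 1 a k) / of_int (ctnt 1 0 a k)"
  using assms
proof (induction k arbitrary: a)
  case 0
  then show ?case by simp
next
  case (Suc k)
  let ?b = "\<lambda>i. a (Suc i)"
  have split: "map a [0..<Suc (Suc k)] = a 0 # map ?b [0..<Suc k]"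
    by (rule map_upt_Suc)
  have ne: "map ?b [0..<Suc k] \<noteq> []" by simp
  have val: "cf_val (a 0 # map ?b [0..<Suc k]) = of_int (a 0) + 1 / cf_val (map ?b [0..<Suc k])"
    using ne by (cases "map ?b [0..<Suc k]") (simp_all del: upt_Suc)
  have IH: "cf_val (map ?b [0..<Suc k]) = of_int (ctnt (?b 0) 1 ?b k) / of_int (ctnt 1 0 ?b k)"
    using Suc.prems by (intro Suc.IH) simp
  have q: "ctnt (?b 0) 1 ?b k = ctnt 1 0 a (Suc k)"
    by (simp only: ctnt_shift) simp
  have p: "ctnt (a 0) 1 a (Suc k) = a 0 * ctnt 1 0 a (Suc k) + ctnt 1 0 ?b k"
    by (subst ctnt_linear) (simp add: ctnt_shift[of 0 1])
  have "ctnt 1 0 a (Suc k) \<ge> 1" using ctnt_pos[of a "Suc k"] Suc.prems by blast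
  then have "(of_int (ctnt 1 0 a (Suc k)) :: rat) \<noteq> 0" by simp
  then show ?case unfolding split val IH q p by (simp add: field_simps)
qed

lemma cf_q_ctnt:
  assumes "\<alpha> \<notin> \<rat>"
  shows "cf_q \<alpha> k = ctnt 1 0 (cf_a \<alpha>) k"
proof -
  let ?p = "ctnt (cf_a \<alpha> 0) 1 (cf_a \<alpha>) k" and ?q = "ctnt 1 0 (cf_a \<alpha>) k"
  have "?q > 0" using ctnt_pos[of "cf_a \<alpha>" k] cf_a_pos[OF assms] by fastforce
  moreover have "cf_conv \<alpha> k = Fract ?p ?q"
    unfolding cf_conv_def using cf_val_ctnt[of "cf_a \<alpha>" k] cf_a_pos[OF assms]
    by (simp only: Fract_of_int_quotient)
  ultimately show ?thesis
    using ctnt_coprime[of "cf_a \<alpha> 0" "cf_a \<alpha>" k]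
    by (simp add: cf_q_def quotient_of_Fract normalize_stable)
qed

lemma cf_q_rec:
  assumes "\<alpha> \<notin> \<rat>"
  shows "cf_q \<alpha> 0 = 1" "cf_q \<alpha> 1 = cf_a \<alpha> 1"
    "cf_q \<alpha> (Suc (Suc k)) = cf_a \<alpha> (Suc (Suc k)) * cf_q \<alpha> (Suc k) + cf_q \<alpha> k"
  by (simp_all add: cf_q_ctnt[OF assms])

lemma cf_q_ge:
  assumes "\<alpha> \<notin> \<rat>"
  shows "cf_q \<alpha> k \<ge> int k"
proof (induction k rule: induct_nat_012)
  case 0
  then show ?case by (simp add: cf_q_rec(1)[OF assms])
next
  case 1
  then show ?case using cf_a_pos[OF assms, of 0] cf_q_rec(2)[OF assms] by simp
next
  case (ge2 k)
  have "cf_q \<alpha> k \<ge> 1" using ctnt_pos[of "cf_a \<alpha>" k] cf_a_pos[OF assms] cf_q_ctnt[OF assms] by simp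
  moreover have "1 * cf_q \<alpha> (Suc k) \<le> cf_a \<alpha> (Suc (Suc k)) * cf_q \<alpha> (Suc k)"
    using cf_a_pos[OF assms, of "Suc k"] ge2 by (intro mult_right_mono) auto
  ultimately show ?case using ge2 cf_q_rec(3)[OF assms, of k] by linarith
qed

lemma cf_K:
  assumes "\<alpha> \<notin> \<rat>" "N \<ge> 1"
  shows "cf_q \<alpha> (cf_K N \<alpha>) \<le> int N" "cf_q \<alpha> k \<le> int N \<Longrightarrow> k \<le> cf_K N \<alpha>"
proof -
  have b: "\<forall>j. cf_q \<alpha> j \<le> int N \<longrightarrow> j \<le> N"
    using cf_q_ge[OF assms(1)] by (metis of_nat_le_iff order_trans)
  have "cf_q \<alpha> 0 \<le> int N" using assms by (simp add: cf_q_rec(1))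
  then show "cf_q \<alpha> (cf_K N \<alpha>) \<le> int N"
    unfolding cf_K_def using b by (intro GreatestI_nat[where P = "\<lambda>k. cf_q \<alpha> k \<le> int N"]) auto
  show "cf_q \<alpha> k \<le> int N \<Longrightarrow> k \<le> cf_K N \<alpha>"
    unfolding cf_K_def using b by (intro Greatest_le_nat[where P = "\<lambda>k. cf_q \<alpha> k \<le> int N"]) auto
qed

end

theory Submission
  imports Defs "HOL-Analysis.Harmonic_Numbers"
begin

text \<open>
  Write \<open>\<parallel>x\<parallel>\<close> for the distance of \<open>x\<close> to the nearest integer and \<open>H\<^sub>n\<close> for the harmonic numbers.
  Three independent estimates are combined.

  The lower bound by \<open>A\<^sub>K\<^sub>+\<^sub>1\<close> uses only the summands at the denominators \<open>q\<^sub>k\<close>: as \<open>\<parallel>q\<^sub>k \<alpha>\<parallel> \<le> 1 / q\<^sub>k\<^sub>+\<^sub>1\<close>,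
  such a summand is at least \<open>q\<^sub>k\<^sub>+\<^sub>1 / q\<^sub>k \<ge> a\<^sub>k\<^sub>+\<^sub>1\<close> (\<open>cf_A_le_S\<close>).

  The quadratic lower bound is a statement about arbitrary points on the circle. For \<open>L\<close> points and
  \<open>0 < k < L\<close>, the arcs from each point to its \<open>k\<close>-th successor have total length \<open>k\<close>, so the reciprocals of
  their lengths sum to at least \<open>L\<^sup>2 / k\<close>; summing over \<open>k\<close> gives \<open>L\<^sup>2 H\<^sub>L\<^sub>-\<^sub>1\<close> (\<open>sum_inverse_gaps_ge\<close>).
  For the points \<open>0, \<alpha>, \<dots>, (L - 1) \<alpha>\<close> modulo 1 this bounds \<open>\<Sum> (L - n) / \<parallel>n \<alpha>\<parallel>\<close> over \<open>n < L\<close> from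
  below, and the weight \<open>1 / n\<close> is a nonnegative combination of the weights \<open>max 0 (L - n)\<close>
  (\<open>sum_triangle_weights\<close>). The outcome \<open>S\<^sub>N \<ge> H\<^sub>N\<^sup>2 - 2 H\<^sub>N\<close> (\<open>S_ge_harm\<close>) exceeds \<open>(ln N)\<^sup>2 / 2\<close> once
  \<open>ln N \<ge> 4\<close>.

  For the upper bound the range of \<open>n\<close> is cut into the blocks \<open>q\<^sub>k \<le> n < q\<^sub>k\<^sub>+\<^sub>1\<close>. By the best approximation
  property (\<open>cf_best_approx\<close>), any \<open>q\<^sub>k\<close> consecutive multiples of \<open>\<alpha>\<close> are \<open>1 / (2 q\<^sub>k)\<close>-separated modulo 1.
  The indices with \<open>\<parallel>n \<alpha>\<parallel> \<ge> 1 / (2 q\<^sub>k)\<close> therefore spread over a grid and contribute a product of two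
  harmonic numbers (\<open>sum_far_le\<close>); the remaining ones are so sparse that they contribute at most
  \<open>8 (a\<^sub>k\<^sub>+\<^sub>1 + 1)\<close> (\<open>sum_near_le\<close>). Summed over the blocks, the harmonic parts telescope. Since the
  number of blocks is at most \<open>2 + 3 ln N\<close> (\<open>cf_K_le_ln\<close>), the total is
  \<open>16 (ln N)\<^sup>2 + O(ln N) + 8 A\<^sub>K\<^sub>+\<^sub>1\<close>, which leaves ample room in the constants.
\<close>

section \<open>Errors of the convergents\<close>

lemma frac_cf_cq_pos:
  assumes "\<alpha> \<notin> \<rat>"
  shows "0 < frac (cf_cq \<alpha> k)"
  using cf_cq_irrational[OF assms] Ints_subset_Rats by (auto simp: frac_gt_0_iff)

lemma cf_a_eq: "of_int (cf_a \<alpha> k) = cf_cq \<alpha> k - frac (cf_cq \<alpha> k)"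
  by (simp add: cf_a_def frac_def)

lemma cf_q_ge_1:
  assumes "\<alpha> \<notin> \<rat>"
  shows "1 \<le> cf_q \<alpha> k"
  using ctnt_pos[of "cf_a \<alpha>" k] cf_a_pos[OF assms] cf_q_ctnt[OF assms] by simp

lemma cf_q_mono_Suc:
  assumes "\<alpha> \<notin> \<rat>"
  shows "cf_q \<alpha> k \<le> cf_q \<alpha> (Suc k)"
  using ctnt_pos[of "cf_a \<alpha>" k] cf_a_pos[OF assms] cf_q_ctnt[OF assms] by simp

lemma cf_q_Suc_le:
  assumes "\<alpha> \<notin> \<rat>"
  shows "cf_q \<alpha> (Suc k) \<le> (cf_a \<alpha> (Suc k) + 1) * cf_q \<alpha> k"
  using cf_q_rec[OF assms] cf_q_mono_Suc[OF assms] by (cases k) (auto simp: algebra_simps)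

lemma cf_A_Suc: "cf_A \<alpha> (Suc k) = cf_A \<alpha> k + cf_a \<alpha> (Suc k)"
  by (simp add: cf_A_def)

definition cf_p :: "real \<Rightarrow> nat \<Rightarrow> int" where
  "cf_p \<alpha> = ctnt (cf_a \<alpha> 0) 1 (cf_a \<alpha>)"

text \<open>
  The sign of the error \<open>q\<^sub>k \<alpha> - p\<^sub>k\<close> is kept, because the alternation of signs drives both the
  identity and the best approximation property below.
\<close>

definition cf_err :: "real \<Rightarrow> nat \<Rightarrow> real" where
  "cf_err \<alpha> k = of_int (cf_q \<alpha> k) * \<alpha> - of_int (cf_p \<alpha> k)"

lemma cf_err_0: "\<alpha> \<notin> \<rat> \<Longrightarrow> cf_err \<alpha> 0 = frac \<alpha>"
  by (simp add: cf_err_def cf_p_def cf_q_rec cf_a_def frac_def)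

lemma cf_err_1: 
  assumes "\<alpha> \<notin> \<rat>"
  shows "cf_err \<alpha> (Suc 0) = of_int (cf_a \<alpha> 1) * frac \<alpha> - 1"
  using cf_q_rec(2)[OF assms]
  by (simp add: cf_err_def cf_p_def cf_a_def[of _ 0] frac_def algebra_simps)

lemma cf_err_rec:
  assumes "\<alpha> \<notin> \<rat>"
  shows "cf_err \<alpha> (Suc (Suc k)) = of_int (cf_a \<alpha> (Suc (Suc k))) * cf_err \<alpha> (Suc k) + cf_err \<alpha> k"
  using cf_q_rec(3)[OF assms]
  by (simp add: cf_err_def cf_p_def algebra_simps)

text \<open>
  In terms of complete quotients \<open>x\<^sub>k\<close>, the recurrence for the errors reads
  \<open>\<theta>\<^sub>k\<^sub>+\<^sub>2 = \<lfloor>x\<^sub>k\<^sub>+\<^sub>2\<rfloor> \<theta>\<^sub>k\<^sub>+\<^sub>1 + \<theta>\<^sub>k\<close>, and the induction hypothesis says \<open>\<theta>\<^sub>k = - x\<^sub>k\<^sub>+\<^sub>2 \<theta>\<^sub>k\<^sub>+\<^sub>1\<close>.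
  So the errors alternate in sign and decrease in absolute value.
\<close>

lemma cf_err_Suc:
  assumes "\<alpha> \<notin> \<rat>"
  shows "cf_err \<alpha> (Suc k) = - cf_err \<alpha> k * frac (cf_cq \<alpha> (Suc k))"
proof (induction k)
  case 0
  show ?case using frac_cf_cq_pos[OF assms, of 0]
    unfolding cf_err_0[OF assms] cf_err_1[OF assms] by (simp add: cf_a_eq field_simps)
next
  case (Suc k)
  let ?f = "frac (cf_cq \<alpha> (Suc k))"
  have "?f > 0" by (rule frac_cf_cq_pos[OF assms])
  then have "cf_err \<alpha> k = - cf_cq \<alpha> (Suc (Suc k)) * cf_err \<alpha> (Suc k)"
    using Suc by (simp add: field_simps)
  then show ?case unfolding cf_err_rec[OF assms, of k] cf_a_eq by (simp add: algebra_simps)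
qed

lemma cf_err_sgn:
  assumes "\<alpha> \<notin> \<rat>"
  shows "0 < (-1) ^ k * cf_err \<alpha> k"
proof (induction k)
  case 0
  then show ?case using frac_cf_cq_pos[OF assms, of 0] by (simp add: cf_err_0[OF assms])
next
  case (Suc k)
  have "(-1) ^ Suc k * cf_err \<alpha> (Suc k) = ((-1) ^ k * cf_err \<alpha> k) * frac (cf_cq \<alpha> (Suc k))"
    by (simp add: cf_err_Suc[OF assms] del: cf_cq.simps)
  with mult_pos_pos[OF Suc frac_cf_cq_pos[OF assms]] show ?case by metis
qed

lemma abs_cf_err:
  assumes "\<alpha> \<notin> \<rat>"
  shows "\<bar>cf_err \<alpha> k\<bar> = (-1) ^ k * cf_err \<alpha> k"
  using abs_of_pos[OF cf_err_sgn[OF assms, of k]] by (simp add: abs_mult)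

lemma abs_cf_err_Suc_le:
  assumes "\<alpha> \<notin> \<rat>"
  shows "\<bar>cf_err \<alpha> (Suc k)\<bar> \<le> \<bar>cf_err \<alpha> k\<bar>"
proof -
  have "\<bar>cf_err \<alpha> (Suc k)\<bar> = \<bar>cf_err \<alpha> k\<bar> * frac (cf_cq \<alpha> (Suc k))"
    by (simp add: cf_err_Suc[OF assms] abs_mult del: cf_cq.simps)
  also have "\<dots> \<le> \<bar>cf_err \<alpha> k\<bar> * 1"
    using frac_lt_1[THEN less_imp_le] by (rule mult_left_mono) simp
  finally show ?thesis by simp
qed

lemma cf_det:
  assumes "\<alpha> \<notin> \<rat>"
  shows "cf_p \<alpha> (Suc k) * cf_q \<alpha> k - cf_p \<alpha> k * cf_q \<alpha> (Suc k) = (-1) ^ k"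
  unfolding cf_p_def cf_q_ctnt[OF assms] by (rule ctnt_det)

text \<open>
  Eliminating \<open>\<alpha>\<close> between two consecutive errors leaves the determinant
  \<open>p\<^sub>k\<^sub>+\<^sub>1 q\<^sub>k - p\<^sub>k q\<^sub>k\<^sub>+\<^sub>1 = \<plusminus>1\<close>; since the errors have opposite signs, nothing cancels.
\<close>

lemma cf_err_balance:
  assumes "\<alpha> \<notin> \<rat>"
  shows "of_int (cf_q \<alpha> (Suc k)) * \<bar>cf_err \<alpha> k\<bar> + of_int (cf_q \<alpha> k) * \<bar>cf_err \<alpha> (Suc k)\<bar> = 1"
proof -
  have "of_int (cf_q \<alpha> (Suc k)) * cf_err \<alpha> k - of_int (cf_q \<alpha> k) * cf_err \<alpha> (Suc k)
      = of_int (cf_p \<alpha> (Suc k) * cf_q \<alpha> k - cf_p \<alpha> k * cf_q \<alpha> (Suc k))"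
    by (simp add: cf_err_def algebra_simps)
  also have "\<dots> = (-1) ^ k" by (simp only: cf_det[OF assms]) simp
  finally have "(-1) ^ k * (of_int (cf_q \<alpha> (Suc k)) * cf_err \<alpha> k
      - of_int (cf_q \<alpha> k) * cf_err \<alpha> (Suc k)) = (1::real)"
    by (simp add: power_mult_distrib[symmetric])
  then show ?thesis unfolding abs_cf_err[OF assms] by (simp add: algebra_simps)
qed

lemma abs_cf_err_le:
  assumes "\<alpha> \<notin> \<rat>"
  shows "\<bar>cf_err \<alpha> k\<bar> * of_int (cf_q \<alpha> (Suc k)) \<le> 1"
proof -
  have "0 \<le> of_int (cf_q \<alpha> k) * \<bar>cf_err \<alpha> (Suc k)\<bar>"
    using cf_q_ge_1[OF assms, of k] by (intro mult_nonneg_nonneg) auto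
  then show ?thesis using cf_err_balance[OF assms, of k] by (simp add: mult.commute)
qed

lemma abs_cf_err_ge:
  assumes "\<alpha> \<notin> \<rat>"
  shows "1 \<le> 2 * of_int (cf_q \<alpha> (Suc k)) * \<bar>cf_err \<alpha> k\<bar>"
proof -
  have "of_int (cf_q \<alpha> k) * \<bar>cf_err \<alpha> (Suc k)\<bar> \<le> of_int (cf_q \<alpha> (Suc k)) * \<bar>cf_err \<alpha> k\<bar>"
    using cf_q_ge_1[OF assms, of k] cf_q_mono_Suc[OF assms, of k] abs_cf_err_Suc_le[OF assms, of k]
    by (intro mult_mono) auto
  then show ?thesis using cf_err_balance[OF assms, of k] by simp
qed

section \<open>Best approximation and the distance to the nearest integer\<close>

text \<open>
  By the determinant identity, \<open>(n, m)\<close> is an integral combination \<open>u (q\<^sub>k, p\<^sub>k) + v (q\<^sub>k\<^sub>+\<^sub>1, p\<^sub>k\<^sub>+\<^sub>1)\<close>.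
  The range of \<open>n\<close> forces \<open>u \<noteq> 0\<close> and forbids \<open>u\<close> and \<open>v\<close> to have the same sign; as the two errors
  have opposite signs, the two contributions to \<open>n \<alpha> - m\<close> add up in absolute value.
\<close>

lemma cf_best_approx:
  assumes irr: "\<alpha> \<notin> \<rat>" and n: "0 < n" "n < cf_q \<alpha> (Suc k)"
  shows "\<bar>cf_err \<alpha> k\<bar> \<le> \<bar>of_int n * \<alpha> - of_int m\<bar>"
proof -
  define s :: int where "s = (-1) ^ k"
  \<comment> \<open>Cramer's rule for the system with determinant \<open>s\<close>, which is its own inverse.\<close>
  define u where "u = s * (n * cf_p \<alpha> (Suc k) - m * cf_q \<alpha> (Suc k))"
  define v where "v = s * (m * cf_q \<alpha> k - n * cf_p \<alpha> k)"
  let ?q = "cf_q \<alpha> k" and ?q' = "cf_q \<alpha> (Suc k)"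
  have ss: "s * s = 1" by (simp add: s_def power_mult_distrib[symmetric])
  have s: "s = cf_p \<alpha> (Suc k) * ?q - cf_p \<alpha> k * ?q'"
    by (simp add: s_def cf_det[OF irr])
  have "u * ?q + v * ?q' = s * (cf_p \<alpha> (Suc k) * ?q - cf_p \<alpha> k * ?q') * n"
    by (simp add: u_def v_def algebra_simps)
  then have nn: "n = u * ?q + v * ?q'" using ss by (simp add: s[symmetric])
  have "u * cf_p \<alpha> k + v * cf_p \<alpha> (Suc k) = s * (cf_p \<alpha> (Suc k) * ?q - cf_p \<alpha> k * ?q') * m"
    by (simp add: u_def v_def algebra_simps)
  then have mm: "m = u * cf_p \<alpha> k + v * cf_p \<alpha> (Suc k)" using ss by (simp add: s[symmetric])
  have eq: "of_int n * \<alpha> - of_int m = of_int u * cf_err \<alpha> k + of_int v * cf_err \<alpha> (Suc k)"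
    unfolding nn mm by (simp add: cf_err_def algebra_simps)
  have q: "?q \<ge> 1" "?q' \<ge> 1" using cf_q_ge_1[OF irr] by auto
  have uv: "(u \<ge> 1 \<and> v \<le> 0) \<or> (u \<le> - 1 \<and> v \<ge> 0)"
  proof -
    have "u \<noteq> 0"
    proof
      assume "u = 0"
      then have "0 < v * ?q'" "v * ?q' < 1 * ?q'" using n nn by auto
      then have "0 < v" "v < 1" using q by (auto simp: zero_less_mult_iff mult_less_cancel_right)
      then show False by simp
    qed
    moreover have "\<not> (u \<ge> 1 \<and> v \<ge> 1)"
    proof
      assume "u \<ge> 1 \<and> v \<ge> 1"
      then have "1 * ?q' \<le> v * ?q'" "0 \<le> u * ?q" using q by (auto intro: mult_right_mono)
      then show False using n nn by linarith
    qed
    moreover have "\<not> (u \<le> -1 \<and> v \<le> -1)"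
    proof
      assume "u \<le> -1 \<and> v \<le> -1"
      then have "v * ?q' \<le> 0" "u * ?q \<le> 0" using q by (auto intro: mult_nonpos_nonneg)
      then show False using n nn by linarith
    qed
    ultimately show ?thesis by linarith
  qed
  let ?t = "\<bar>cf_err \<alpha> k\<bar>" and ?t' = "\<bar>cf_err \<alpha> (Suc k)\<bar>"
  have "\<bar>of_int n * \<alpha> - of_int m\<bar> = \<bar>(-1) ^ k * (of_int n * \<alpha> - of_int m)\<bar>"
    by (simp add: abs_mult)
  also have "(-1) ^ k * (of_int n * \<alpha> - of_int m) = of_int u * ?t - of_int v * ?t'"
    unfolding eq abs_cf_err[OF irr] by (simp add: algebra_simps)
  finally have abs: "\<bar>of_int n * \<alpha> - of_int m\<bar> = \<bar>of_int u * ?t - of_int v * ?t'\<bar>" .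
  from uv show ?thesis
  proof
    assume "u \<ge> 1 \<and> v \<le> 0"
    then have "real_of_int u \<ge> 1" "real_of_int v \<le> 0" by simp_all
    then have "1 * ?t \<le> of_int u * ?t" "of_int v * ?t' \<le> 0"
      by (intro mult_right_mono mult_nonpos_nonneg; simp)+
    then show ?thesis unfolding abs by linarith
  next
    assume "u \<le> -1 \<and> v \<ge> 0"
    then have "real_of_int u \<le> -1" "real_of_int v \<ge> 0" by simp_all
    then have "of_int u * ?t \<le> -1 * ?t" "of_int v * ?t' \<ge> 0"
      by (intro mult_right_mono mult_nonneg_nonneg; simp)+
    then show ?thesis unfolding abs by linarith
  qed
qed

lemma dist_int_nonneg: "0 \<le> dist_int x"
  by (simp add: dist_int_def)

lemma dist_int_le_half: "dist_int x \<le> 1 / 2"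
  using of_int_round_abs_le[of x] by (simp add: dist_int_def abs_minus_commute)

lemma dist_int_le: "dist_int x \<le> \<bar>x - of_int m\<bar>"
  using round_diff_minimal[of x m] by (simp add: dist_int_def)

lemma dist_int_pos:
  assumes "x \<notin> \<rat>"
  shows "0 < dist_int x"
  using assms unfolding dist_int_def by (metis Rats_of_int eq_iff_diff_eq_0 zero_less_abs_iff)

lemma irrational_mult_nat:
  fixes \<alpha> :: real
  assumes "\<alpha> \<notin> \<rat>" "0 < n"
  shows "real n * \<alpha> \<notin> \<rat>"
proof
  assume "real n * \<alpha> \<in> \<rat>"
  then have "real n * \<alpha> / real n \<in> \<rat>" by (intro Rats_divide) auto
  then show False using assms by simp
qed

lemma dist_int_cf_q_le:
  assumes "\<alpha> \<notin> \<rat>"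
  shows "dist_int (of_int (cf_q \<alpha> k) * \<alpha>) * of_int (cf_q \<alpha> (Suc k)) \<le> 1"
proof -
  have "dist_int (of_int (cf_q \<alpha> k) * \<alpha>) * of_int (cf_q \<alpha> (Suc k))
     \<le> \<bar>cf_err \<alpha> k\<bar> * of_int (cf_q \<alpha> (Suc k))"
    using cf_q_ge_1[OF assms, of "Suc k"] dist_int_le
    unfolding cf_err_def by (intro mult_right_mono) auto
  then show ?thesis using abs_cf_err_le[OF assms, of k] by linarith
qed

lemma dist_int_ge_below_cf_q:
  assumes "\<alpha> \<notin> \<rat>" "0 < n" "int n < cf_q \<alpha> k"
  shows "1 \<le> 2 * of_int (cf_q \<alpha> k) * dist_int (real n * \<alpha>)"
proof (cases k)
  case 0
  then show ?thesis using assms cf_q_rec(1)[OF assms(1)] by simp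
next
  case (Suc j)
  have "\<bar>cf_err \<alpha> j\<bar> \<le> dist_int (real n * \<alpha>)"
    using cf_best_approx[OF assms(1), of "int n" j] assms Suc by (simp add: dist_int_def)
  then have "2 * of_int (cf_q \<alpha> k) * \<bar>cf_err \<alpha> j\<bar> \<le> 2 * of_int (cf_q \<alpha> k) * dist_int (real n * \<alpha>)"
    using cf_q_ge_1[OF assms(1), of k] by (intro mult_left_mono) auto
  then show ?thesis using abs_cf_err_ge[OF assms(1), of j] Suc by simp
qed

definition cf_qn :: "real \<Rightarrow> nat \<Rightarrow> nat" where
  "cf_qn \<alpha> k = nat (cf_q \<alpha> k)"

lemma int_cf_qn: "\<alpha> \<notin> \<rat> \<Longrightarrow> int (cf_qn \<alpha> k) = cf_q \<alpha> k"
  using cf_q_ge_1[of \<alpha> k] by (simp add: cf_qn_def)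

lemma real_cf_qn: "\<alpha> \<notin> \<rat> \<Longrightarrow> real_of_int (cf_q \<alpha> k) = real (cf_qn \<alpha> k)"
  using cf_q_ge_1[of \<alpha> k] by (simp add: cf_qn_def)

lemma cf_qn_pos: "\<alpha> \<notin> \<rat> \<Longrightarrow> 0 < cf_qn \<alpha> k"
  using cf_q_ge_1[of \<alpha> k] by (simp add: cf_qn_def)

lemma cf_qn_le_Suc: "\<alpha> \<notin> \<rat> \<Longrightarrow> cf_qn \<alpha> k \<le> cf_qn \<alpha> (Suc k)"
  using cf_q_mono_Suc[of \<alpha> k] by (simp add: cf_qn_def)

text \<open>
  Doubling every second step is enough to make the number of blocks below \<open>N\<close> logarithmic in \<open>N\<close>.
\<close>

lemma cf_q_growth:
  assumes "\<alpha> \<notin> \<rat>"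
  shows "2 ^ k \<le> cf_q \<alpha> k * cf_q \<alpha> (Suc k)"
proof (induction k)
  case 0
  then show ?case using cf_q_ge_1[OF assms, of 1] by (simp add: cf_q_rec(1)[OF assms])
next
  case (Suc k)
  let ?q = "cf_q \<alpha> (Suc k)"
  have "1 * ?q \<le> cf_a \<alpha> (Suc (Suc k)) * ?q"
    using cf_a_pos[OF assms] cf_q_ge_1[OF assms, of "Suc k"] by (intro mult_right_mono) auto
  then have "2 * cf_q \<alpha> k \<le> cf_q \<alpha> (Suc (Suc k))"
    using cf_q_rec(3)[OF assms, of k] cf_q_mono_Suc[OF assms, of k] by linarith
  then have "?q * (2 * cf_q \<alpha> k) \<le> ?q * cf_q \<alpha> (Suc (Suc k))"
    using cf_q_ge_1[OF assms, of "Suc k"] by (intro mult_left_mono) auto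
  then show ?case using Suc by (simp add: algebra_simps)
qed

lemma cf_K_le_ln:
  assumes "\<alpha> \<notin> \<rat>" "1 \<le> N"
  shows "real (cf_K N \<alpha>) \<le> 1 + 3 * ln (real N)"
proof (cases "cf_K N \<alpha>")
  case 0
  then show ?thesis using assms by simp
next
  case (Suc j)
  have q: "cf_q \<alpha> (Suc j) \<le> int N" "cf_q \<alpha> j \<le> int N"
    using cf_K(1)[OF assms] cf_q_mono_Suc[OF assms(1), of j] Suc by auto
  have "cf_q \<alpha> j * cf_q \<alpha> (Suc j) \<le> int N * int N"
    using q cf_q_ge_1[OF assms(1), of "Suc j"] by (intro mult_mono) auto
  then have "2 ^ j \<le> int (N * N)"
    using cf_q_growth[OF assms(1), of j] by simp
  then have "2 ^ j \<le> N * N"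
    by (metis of_nat_le_iff of_nat_numeral of_nat_power)
  then have "real (2 ^ j) \<le> real (N * N)"
    by (simp only: of_nat_le_iff)
  then have "ln (2 ^ j) \<le> ln (real N * real N)"
    using assms(2) by (subst ln_le_cancel_iff) auto
  then have "real j * ln 2 \<le> 2 * ln (real N)"
    using assms(2) by (simp add: ln_realpow ln_mult)
  moreover have "real j * (2 / 3) \<le> real j * ln 2"
    using ln2_ge_two_thirds by (intro mult_left_mono) auto
  ultimately show ?thesis using Suc by simp
qed

section \<open>Arcs between multiples modulo one\<close>

text \<open>
  This is the inequality between arithmetic and harmonic mean, proved by bounding \<open>1 / d\<close> below by
  its tangent at the mean value \<open>d = s / n\<close>.
\<close>

lemma sum_inverse_ge:
  fixes d :: "nat \<Rightarrow> real"
  assumes "\<And>i. i < n \<Longrightarrow> 0 < d i" "(\<Sum>i<n. d i) = s" "0 < s"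
  shows "(real n)\<^sup>2 / s \<le> (\<Sum>i<n. 1 / d i)"
proof -
  define c where "c = real n / s"
  have "(real n)\<^sup>2 / s = (\<Sum>i<n. 2 * c - c\<^sup>2 * d i)"
    using assms(3) unfolding sum_subtractf sum_distrib_left[symmetric] assms(2)
    by (simp add: c_def field_simps power2_eq_square)
  also have "\<dots> \<le> (\<Sum>i<n. 1 / d i)"
  proof (rule sum_mono)
    fix i assume "i \<in> {..<n}"
    then have d: "0 < d i" using assms(1) by simp
    have "0 \<le> (c * d i - 1)\<^sup>2" by simp
    then have "(2 * c - c\<^sup>2 * d i) * d i \<le> 1" by (simp add: power2_eq_square algebra_simps)
    then show "2 * c - c\<^sup>2 * d i \<le> 1 / d i" using d by (simp only: pos_le_divide_eq)
  qed
  finally show ?thesis .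
qed

lemma bij_betw_cyclic_shift:
  fixes i L :: nat
  assumes "i < L"
  shows "bij_betw (\<lambda>k. (i + k) mod L) {1..<L} ({..<L} - {i})"
proof -
  have mod: "(i + k) mod L = (if i + k < L then i + k else i + k - L)" if "k < L" for k
    using assms that by (simp add: mod_if)
  have inj: "inj_on (\<lambda>k. (i + k) mod L) {1..<L}"
  proof (rule inj_onI)
    fix k k' assume "k \<in> {1..<L}" "k' \<in> {1..<L}" "(i + k) mod L = (i + k') mod L"
    then show "k = k'" using assms mod[of k] mod[of k'] by (simp split: if_splits)
  qed
  have "(\<lambda>k. (i + k) mod L) ` {1..<L} = {..<L} - {i}"
  proof (rule card_subset_eq)
    show "(\<lambda>k. (i + k) mod L) ` {1..<L} \<subseteq> {..<L} - {i}"
      using assms mod by (auto split: if_splits)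
    show "card ((\<lambda>k. (i + k) mod L) ` {1..<L}) = card ({..<L} - {i})"
      unfolding card_image[OF inj] using assms by simp
  qed simp
  with inj show ?thesis by (simp add: bij_betw_def)
qed

text \<open>
  Arrange the \<open>L\<close> points in cyclic order on the circle of length 1. For fixed \<open>k\<close>, the \<open>L\<close> arcs from a
  point to its \<open>k\<close>-th successor cover the circle exactly \<open>k\<close> times, so their lengths add up to \<open>k\<close> and
  the reciprocals of their lengths add up to at least \<open>L\<^sup>2 / k\<close>. Every ordered pair of distinct points
  is counted for exactly one \<open>k\<close> between \<open>1\<close> and \<open>L - 1\<close>, whence the harmonic number.
\<close>

lemma sum_inverse_gaps_ge:
  fixes X :: "real set"
  assumes X: "finite X" "X \<subseteq> {0..<1}"
  shows "(real (card X))\<^sup>2 * harm (card X - 1) \<le> (\<Sum>x\<in>X. \<Sum>y\<in>X - {x}. 1 / frac (y - x))"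
proof -
  define L where "L = card X"
  define xs where "xs = sorted_list_of_set X"
  have xs: "set xs = X" "length xs = L" "distinct xs" "sorted_wrt (<) xs"
    using X by (simp_all add: xs_def L_def)
  have less: "xs ! i < xs ! j" if "i < j" "j < L" for i j
    using xs that by (intro sorted_wrt_nth_less) auto
  have range: "0 \<le> xs ! i" "xs ! i < 1" if "i < L" for i
    using X(2) xs nth_mem[of i xs] that by auto
  \<comment> \<open>The points in increasing order, continued along the real line so that \<open>z (i + L) = z i + 1\<close>.\<close>
  define z where "z i = xs ! (i mod L) + real (i div L)" for i
  have gap: "0 < z (i + k) - z i \<and> z (i + k) - z i = frac (xs ! ((i + k) mod L) - xs ! i)"
    if "i < L" "1 \<le> k" "k < L" for i k
  proof (cases "i + k < L")
    case True
    have "xs ! i < xs ! (i + k)" using that True by (intro less) auto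
    moreover have "frac (xs ! (i + k) - xs ! i) = xs ! (i + k) - xs ! i"
      using calculation range[of i] range[of "i + k"] that True by (simp add: frac_eq)
    ultimately show ?thesis using that True by (simp add: z_def)
  next
    case False
    then have m: "(i + k) mod L = i + k - L" "(i + k) div L = 1"
      using that by (simp_all add: mod_if div_if)
    have j: "i + k - L < L" using that by simp
    have "xs ! (i + k - L) < xs ! i" using that False by (intro less) auto
    moreover have "frac (xs ! (i + k - L) - xs ! i) = xs ! (i + k - L) - xs ! i + 1"
      using calculation range[OF that(1)] range[OF j]
      by (subst frac_1_eq[symmetric]) (simp add: frac_eq)
    ultimately show ?thesis using that m range[OF that(1)] range[OF j]
      by (simp add: z_def)
  qed
  have total: "(\<Sum>i<L. z (i + k) - z i) = real k" if "0 < L" for k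
  proof (induction k)
    case (Suc k)
    have "(\<Sum>i<L. z (i + Suc k) - z (i + k)) = z (L + k) - z k"
      using sum_lessThan_telescope[of "\<lambda>i. z (i + k)" L] by simp
    also have "\<dots> = 1" using that by (simp add: z_def)
    finally have "(\<Sum>i<L. z (i + Suc k) - z (i + k)) = 1" .
    then have "(\<Sum>i<L. (z (i + Suc k) - z (i + k)) + (z (i + k) - z i)) = 1 + real k"
      using Suc by (simp only: sum.distrib)
    then show ?case by simp
  qed simp
  have "(real L)\<^sup>2 * harm (L - 1) = (\<Sum>k=1..<L. (real L)\<^sup>2 / real k)"
    by (cases L) (simp_all add: harm_def sum_distrib_left divide_inverse atLeastLessThanSuc_atLeastAtMost)
  also have "\<dots> \<le> (\<Sum>k=1..<L. \<Sum>i<L. 1 / (z (i + k) - z i))"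
  proof (rule sum_mono)
    fix k assume "k \<in> {1..<L}"
    then show "(real L)\<^sup>2 / real k \<le> (\<Sum>i<L. 1 / (z (i + k) - z i))"
      using gap[THEN conjunct1] total[of k] by (intro sum_inverse_ge) auto
  qed
  also have "\<dots> = (\<Sum>i<L. \<Sum>k=1..<L. 1 / (z (i + k) - z i))"
    by (rule sum.swap)
  also have "\<dots> = (\<Sum>i<L. \<Sum>y\<in>X - {xs ! i}. 1 / frac (y - xs ! i))"
  proof (rule sum.cong[OF refl])
    fix i assume "i \<in> {..<L}"
    then have i: "i < L" by simp
    have "bij_betw ((!) xs) {..<L} X" using xs by (intro bij_betw_nth) auto
    then have "bij_betw ((!) xs) ({..<L} - {i}) (X - {xs ! i})"
      by (rule bij_betw_DiffI) (use xs i in \<open>auto simp: bij_betw_def\<close>)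
    from bij_betw_trans[OF bij_betw_cyclic_shift[OF i] this]
    have "bij_betw (\<lambda>k. xs ! ((i + k) mod L)) {1..<L} (X - {xs ! i})" by (simp add: o_def)
    from sum.reindex_bij_betw[OF this, of "\<lambda>y. 1 / frac (y - xs ! i)"]
    have "(\<Sum>k=1..<L. 1 / frac (xs ! ((i + k) mod L) - xs ! i)) = (\<Sum>y\<in>X - {xs ! i}. 1 / frac (y - xs ! i))" .
    then show "(\<Sum>k=1..<L. 1 / (z (i + k) - z i)) = (\<Sum>y\<in>X - {xs ! i}. 1 / frac (y - xs ! i))"
      using gap[OF i] by simp
  qed
  also have "\<dots> = (\<Sum>x\<in>X. \<Sum>y\<in>X - {x}. 1 / frac (y - x))"
    using sum.reindex_bij_betw[OF bij_betw_nth[OF xs(3) refl refl],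
        of "\<lambda>x. \<Sum>y\<in>X - {x}. 1 / frac (y - x)"] xs by simp
  finally show ?thesis by (simp add: L_def)
qed

text \<open>
  Each positive difference \<open>n\<close> occurs \<open>L - n\<close> times among the ordered pairs of indices below \<open>L\<close>,
  and so does \<open>- n\<close>.
\<close>

lemma sum_differences:
  fixes f :: "int \<Rightarrow> real"
  shows "(\<Sum>i<L. \<Sum>j\<in>{..<L} - {i}. f (int j - int i))
     = (\<Sum>n=1..<L. (real L - real n) * (f (int n) + f (- int n)))"
proof (induction L)
  case (Suc L)
  have row: "(\<Sum>j\<in>{..<Suc L} - {i}. f (int j - int i))
     = (\<Sum>j\<in>{..<L} - {i}. f (int j - int i)) + f (int (L - i))" if "i < L" for i
  proof -
    have "{..<Suc L} - {i} = insert L ({..<L} - {i})" using that by auto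
    then show ?thesis using that by (simp add: of_nat_diff)
  qed
  have last: "{..<Suc L} - {L} = {..<L}" by auto
  have rev: "(\<Sum>i<L. g (L - i)) = (\<Sum>n=1..<Suc L. g n)" for g :: "nat \<Rightarrow> real"
    by (rule sum.reindex_bij_witness[of _ "\<lambda>n. L - n" "\<lambda>i. L - i"]) auto
  have "(\<Sum>i<Suc L. \<Sum>j\<in>{..<Suc L} - {i}. f (int j - int i))
      = (\<Sum>i<L. \<Sum>j\<in>{..<L} - {i}. f (int j - int i))
        + ((\<Sum>i<L. f (int (L - i))) + (\<Sum>i<L. f (- int (L - i))))"
    by (simp add: row last sum.distrib of_nat_diff)
  also have "(\<Sum>i<L. f (int (L - i))) + (\<Sum>i<L. f (- int (L - i)))
      = (\<Sum>n=1..<Suc L. f (int n) + f (- int n))"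
    using rev[of "\<lambda>n. f (int n)"] rev[of "\<lambda>n. f (- int n)"] by (simp only: sum.distrib)
  finally show ?case
    by (simp add: Suc sum.distrib[symmetric] algebra_simps)
qed simp

text \<open>
  Of the two arcs from \<open>0\<close> to \<open>x\<close>, one has length \<open>\<parallel>x\<parallel>\<close> and the other at least \<open>1/2\<close>. Keeping both
  arcs doubles what the arc sums yield for \<open>\<Sum> 1 / \<parallel>x\<parallel>\<close>; using only one arc per pair would lose
  this factor and end exactly at the constant \<open>1/2\<close>, with no room for lower order terms.
\<close>

lemma inverse_frac_le:
  assumes "x \<notin> \<rat>"
  shows "1 / frac x + 1 / frac (- x) \<le> 1 / dist_int x + 2"
proof -
  have x: "x \<notin> \<int>" using assms Ints_subset_Rats by blast
  define t where "t = frac x"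
  have t: "0 < t" "t < 1" using x frac_lt_1 by (auto simp: t_def)
  have neg: "frac (- x) = 1 - t" using x by (simp add: frac_neg t_def)
  have d: "dist_int x \<le> t" "dist_int x \<le> 1 - t"
    using dist_int_le[of x "\<lfloor>x\<rfloor>"] dist_int_le[of x "\<lfloor>x\<rfloor> + 1"] t by (simp_all add: t_def frac_def)
  have "1 / t \<le> 1 / dist_int x" "1 / (1 - t) \<le> 1 / dist_int x"
    using d t dist_int_pos[OF assms] by (auto intro!: divide_left_mono)
  moreover have "1 / t \<le> 2 \<or> 1 / (1 - t) \<le> 2"
    using t by (auto simp: divide_simps)
  ultimately show ?thesis unfolding neg t_def[symmetric] by linarith
qed

text \<open>
  The arc estimate is applied to the points \<open>i \<alpha>\<close> modulo 1 for \<open>i < L\<close>, whose differences are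
  multiples of \<open>\<alpha>\<close>. The other arc costs at most \<open>2\<close> per unordered pair, hence at most \<open>L\<^sup>2\<close> in total.
\<close>

lemma sum_weighted_inverse_dist_int_ge:
  assumes irr: "\<alpha> \<notin> \<rat>"
  shows "(real L)\<^sup>2 * (harm (L - 1) - 1) \<le> (\<Sum>n=1..<L. (real L - real n) / dist_int (real n * \<alpha>))"
proof -
  define x where "x i = frac (real i * \<alpha>)" for i :: nat
  define f where "f m = 1 / frac (of_int m * \<alpha>)" for m :: int
  have fracx: "frac (x j - x i) = frac (of_int (int j - int i) * \<alpha>)" for i j
  proof -
    have "frac (x j - x i) = frac (real j * \<alpha> - real i * \<alpha>)"
      unfolding x_def by (subst frac_diff[of "real j * \<alpha>" "real i * \<alpha>"]) (simp only: diff_conv_add_uminus)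
    then show ?thesis by (simp add: algebra_simps)
  qed
  have irr': "of_int m * \<alpha> \<notin> \<rat>" if "m \<noteq> 0" for m
  proof
    assume "of_int m * \<alpha> \<in> \<rat>"
    then have "of_int m * \<alpha> / of_int m \<in> \<rat>" by (intro Rats_divide) auto
    then show False using irr that by simp
  qed
  have inj: "inj_on x {..<L}"
  proof (rule inj_onI, rule ccontr)
    fix i j assume "x i = x j" "i \<noteq> j"
    then have "frac (of_int (int j - int i) * \<alpha>) = 0" using fracx[of j i] by simp
    then show False using irr'[of "int j - int i"] \<open>i \<noteq> j\<close> Ints_subset_Rats by auto
  qed
  have "(real L)\<^sup>2 * harm (L - 1) \<le> (\<Sum>u\<in>x ` {..<L}. \<Sum>v\<in>x ` {..<L} - {u}. 1 / frac (v - u))"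
  proof -
    have "x ` {..<L} \<subseteq> {0..<1}" using frac_lt_1 by (auto simp: x_def)
    from sum_inverse_gaps_ge[OF _ this] show ?thesis by (simp add: card_image[OF inj])
  qed
  also have "\<dots> = (\<Sum>i<L. \<Sum>v\<in>x ` {..<L} - {x i}. 1 / frac (v - x i))"
    by (simp add: sum.reindex[OF inj])
  also have "\<dots> = (\<Sum>i<L. \<Sum>j\<in>{..<L} - {i}. f (int j - int i))"
  proof (rule sum.cong[OF refl])
    fix i assume "i \<in> {..<L}"
    then have "x ` {..<L} - {x i} = x ` ({..<L} - {i})"
      using inj by (simp add: inj_on_image_set_diff[of x "{..<L}"])
    then have "(\<Sum>v\<in>x ` {..<L} - {x i}. 1 / frac (v - x i)) = (\<Sum>j\<in>{..<L} - {i}. 1 / frac (x j - x i))"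
      using inj by (simp add: sum.reindex inj_on_diff)
    then show "(\<Sum>v\<in>x ` {..<L} - {x i}. 1 / frac (v - x i)) = (\<Sum>j\<in>{..<L} - {i}. f (int j - int i))"
      by (simp only: fracx f_def)
  qed
  also have "\<dots> = (\<Sum>n=1..<L. (real L - real n) * (f (int n) + f (- int n)))"
    by (rule sum_differences)
  also have "\<dots> \<le> (\<Sum>n=1..<L. (real L - real n) * (1 / dist_int (real n * \<alpha>) + 2))"
    using inverse_frac_le[OF irrational_mult_nat[OF irr]]
    by (intro sum_mono mult_left_mono) (auto simp: f_def)
  also have "\<dots> = (\<Sum>n=1..<L. (real L - real n) / dist_int (real n * \<alpha>)) + (\<Sum>n=1..<L. (real L - real n) * 2)"
    by (simp add: sum.distrib[symmetric] algebra_simps)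
  also have "(\<Sum>n=1..<L. (real L - real n) * 2) = (\<Sum>i<L. \<Sum>j\<in>{..<L} - {i}. 1)"
    using sum_differences[of "\<lambda>_. 1" L] by simp
  also have "\<dots> \<le> (\<Sum>i<L. real L)" by (intro sum_mono) simp
  also have "\<dots> = (real L)\<^sup>2" by (simp add: power2_eq_square)
  finally show ?thesis by (simp add: algebra_simps)
qed

section \<open>The quadratic lower bound\<close>

text \<open>
  The weight \<open>1 / n\<close> is, up to a truncation error, a nonnegative combination of the triangle weights
  \<open>max 0 (L - n)\<close>: the coefficient of \<open>L\<close> is the second difference
  \<open>1 / (L - 1) - 2 / L + 1 / (L + 1) = 2 / ((L - 1) L (L + 1))\<close> of the convex function \<open>1 / x\<close>.
  The subtracted fraction is the value at \<open>n\<close> of the linear function that interpolates \<open>1 / x\<close> at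
  \<open>N + 1\<close> and \<open>N + 2\<close>.
\<close>

lemma sum_triangle_weights:
  fixes g :: "nat \<Rightarrow> real"
  shows "(\<Sum>L=2..Suc N. 2 / ((real L - 1) * real L * (real L + 1)) * (\<Sum>n=1..<L. (real L - real n) * g n))
    = (\<Sum>n=1..Suc N. (1 / real n - (2 * real (Suc N) + 1 - real n) / (real (Suc N) * (real (Suc N) + 1))) * g n)"
proof (induction N)
  case (Suc N)
  let ?w = "\<lambda>L n. 2 / ((real L - 1) * real L * (real L + 1)) * (real L - real n)"
  let ?c = "\<lambda>L n. 1 / real n - (2 * real L + 1 - real n) / (real L * (real L + 1))"
  have step: "?w (Suc (Suc N)) n * g n + ?c (Suc N) n * g n = ?c (Suc (Suc N)) n * g n" for n
  proof -
    define M where "M = real (Suc N)"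
    have M: "M > 0" by (simp add: M_def)
    have SS: "real (Suc (Suc N)) = M + 1" by (simp add: M_def)
    have "(2 * M + 1 - real n) / (M * (M + 1)) - (2 * (M + 1) + 1 - real n) / ((M + 1) * (M + 1 + 1))
       = 2 / ((M + 1 - 1) * (M + 1) * (M + 1 + 1)) * (M + 1 - real n)"
      using M by (simp add: divide_simps) (simp add: algebra_simps)
    then have "?w (Suc (Suc N)) n + ?c (Suc N) n = ?c (Suc (Suc N)) n"
      unfolding SS M_def[symmetric] by linarith
    then show ?thesis by (metis distrib_right)
  qed
  have zero: "?c (Suc (Suc N)) (Suc (Suc N)) = 0"
    by (simp add: divide_simps)
  have "(\<Sum>L=2..Suc (Suc N). 2 / ((real L - 1) * real L * (real L + 1)) * (\<Sum>n=1..<L. (real L - real n) * g n))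
     = (\<Sum>n=1..Suc N. ?w (Suc (Suc N)) n * g n) + (\<Sum>n=1..Suc N. ?c (Suc N) n * g n)"
    unfolding Suc[symmetric]
    by (subst sum.nat_ivl_Suc', simp)
      (simp only: sum_distrib_left mult.assoc atLeastLessThanSuc_atLeastAtMost)
  also have "\<dots> = (\<Sum>n=1..Suc N. ?c (Suc (Suc N)) n * g n)"
    unfolding sum.distrib[symmetric] step ..
  also have "\<dots> = (\<Sum>n=1..Suc (Suc N). ?c (Suc (Suc N)) n * g n)"
    using zero by simp
  finally show ?case .
qed simp

text \<open>
  Inserting the weighted estimate into the triangle decomposition leaves the sum of
  \<open>2 (H\<^sub>L\<^sub>-\<^sub>1 - 1) / L\<close>, which telescopes up to the squares \<open>1 / L\<^sup>2\<close>, because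
  \<open>H\<^sub>L\<^sup>2 - H\<^sub>L\<^sub>-\<^sub>1\<^sup>2 = 2 H\<^sub>L\<^sub>-\<^sub>1 / L + 1 / L\<^sup>2\<close>.
\<close>

lemma S_ge_harm:
  assumes irr: "\<alpha> \<notin> \<rat>" and "1 \<le> N"
  shows "(harm N)\<^sup>2 - 2 * harm N \<le> S N \<alpha>"
proof -
  let ?w = "\<lambda>L. 2 / ((real L - 1) * real L * (real L + 1))"
  let ?T = "\<lambda>L. \<Sum>n=1..<L. (real L - real n) * (1 / dist_int (real n * \<alpha>))"
  have wT: "2 * (harm m - 1) / (real m + 1) \<le> ?w (Suc m) * ?T (Suc m)" if "1 \<le> m" for m
  proof -
    have h: "1 \<le> (harm m :: real)" using harm_mono[OF that, where 'a = real] by (simp add: harm_expand)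
    have "2 / (real m + 1) \<le> ?w (Suc m) * (real (Suc m))\<^sup>2"
      using that by (simp add: divide_simps power2_eq_square) (simp add: algebra_simps)
    from mult_right_mono[OF this, of "harm m - 1"] h
    have "2 * (harm m - 1) / (real m + 1) \<le> ?w (Suc m) * ((real (Suc m))\<^sup>2 * (harm m - 1))"
      by (simp add: mult.assoc)
    also have "\<dots> \<le> ?w (Suc m) * ?T (Suc m)"
      using sum_weighted_inverse_dist_int_ge[OF irr, of "Suc m"]
      by (intro mult_left_mono) auto
    finally show ?thesis .
  qed
  obtain M where M: "N = Suc M" using assms(2) by (cases N) auto
  \<comment> \<open>The additional summand \<open>1 / (M + 1)\<close> pays for the squares: its decrease from one step to the next
    is at least \<open>d\<^sup>2\<close>.\<close>
  have "(harm (Suc M))\<^sup>2 - 2 * harm (Suc M) + 1 / real (Suc M) \<le> (\<Sum>L=2..Suc M. ?w L * ?T L)" for M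
  proof (induction M)
    case 0
    then show ?case by (simp add: harm_expand)
  next
    case (Suc M)
    define h d where "h = (harm (Suc M) :: real)" and "d = 1 / real (Suc (Suc M))"
    have harm: "harm (Suc (Suc M)) = h + d" by (simp add: h_def d_def harm_Suc[of "Suc M"] divide_inverse)
    have "d + d\<^sup>2 \<le> 1 / real (Suc M)"
      by (simp add: d_def divide_simps power2_eq_square) (simp add: algebra_simps)
    moreover have "2 * (h - 1) * d \<le> ?w (Suc (Suc M)) * ?T (Suc (Suc M))"
      using wT[of "Suc M"] by (simp add: h_def d_def add_ac)
    moreover have "(h + d)\<^sup>2 - 2 * (h + d) = h\<^sup>2 - 2 * h + 2 * (h - 1) * d + d\<^sup>2"
      by (simp add: power2_eq_square algebra_simps)
    moreover have "(\<Sum>L=2..Suc (Suc M). ?w L * ?T L)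
        = ?w (Suc (Suc M)) * ?T (Suc (Suc M)) + (\<Sum>L=2..Suc M. ?w L * ?T L)"
      by (rule sum.nat_ivl_Suc') simp
    ultimately show ?case using Suc unfolding harm h_def[symmetric] d_def[symmetric] by linarith
  qed
  note sum_ge = this[of M]
  have "(\<Sum>L=2..Suc M. ?w L * ?T L)
      = (\<Sum>n=1..Suc M. (1 / real n - (2 * real (Suc M) + 1 - real n) / (real (Suc M) * (real (Suc M) + 1)))
          * (1 / dist_int (real n * \<alpha>)))"
    by (rule sum_triangle_weights)
  also have "\<dots> \<le> (\<Sum>n=1..Suc M. 1 / real n * (1 / dist_int (real n * \<alpha>)))"
    using dist_int_nonneg by (intro sum_mono mult_right_mono) auto
  also have "\<dots> = S N \<alpha>" by (simp add: S_def M)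
  finally have "(\<Sum>L=2..Suc M. ?w L * ?T L) \<le> S N \<alpha>" .
  moreover have "0 \<le> 1 / real (Suc M)" by simp
  ultimately show ?thesis using sum_ge unfolding M by linarith
qed

lemma S_ge_ln:
  assumes irr: "\<alpha> \<notin> \<rat>" and N: "1 \<le> N" "4 \<le> ln (real N)"
  shows "1 / 2 * (ln (real N))\<^sup>2 \<le> S N \<alpha>"
proof -
  have "ln (real N) \<le> ln (real N + 1)" using N by (subst ln_le_cancel_iff) auto
  also have "\<dots> \<le> harm N" by (rule ln_le_harm)
  finally have h: "ln (real N) \<le> harm N" .
  have "1 / 2 * (ln (real N))\<^sup>2 \<le> 1 / 2 * (harm N)\<^sup>2"
    using h N by (intro mult_left_mono power_mono) auto
  also have "4 * harm N \<le> (harm N :: real)\<^sup>2"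
    using h N unfolding power2_eq_square by (intro mult_right_mono harm_nonneg) linarith
  then have "1 / 2 * (harm N)\<^sup>2 \<le> (harm N)\<^sup>2 - 2 * (harm N :: real)" by simp
  also have "\<dots> \<le> S N \<alpha>" by (rule S_ge_harm[OF irr N(1)])
  finally show ?thesis .
qed

section \<open>The lower bound by partial quotients\<close>

lemma S_add_le:
  assumes "m < n"
  shows "S m \<alpha> + 1 / (real n * dist_int (real n * \<alpha>)) \<le> S n \<alpha>"
proof -
  let ?g = "\<lambda>n. 1 / (real n * dist_int (real n * \<alpha>))"
  have "S m \<alpha> + ?g n = sum ?g (insert n {1..m})" using assms by (simp add: S_def)
  also have "\<dots> \<le> sum ?g {1..n}"
    using assms dist_int_nonneg by (intro sum_mono2) auto
  finally show ?thesis by (simp add: S_def)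
qed

lemma S_mono:
  assumes "m \<le> n"
  shows "S m \<alpha> \<le> S n \<alpha>"
  unfolding S_def using assms dist_int_nonneg by (intro sum_mono2) auto

lemma cf_term_ge:
  assumes irr: "\<alpha> \<notin> \<rat>"
  shows "real (cf_qn \<alpha> (Suc k)) / real (cf_qn \<alpha> k)
    \<le> 1 / (real (cf_qn \<alpha> k) * dist_int (real (cf_qn \<alpha> k) * \<alpha>))"
proof -
  let ?q = "cf_qn \<alpha> k"
  have "dist_int (real ?q * \<alpha>) * real (cf_qn \<alpha> (Suc k)) \<le> 1"
    using dist_int_cf_q_le[OF irr, of k] by (simp add: real_cf_qn[OF irr])
  moreover have "0 < dist_int (real ?q * \<alpha>)"
    using cf_qn_pos[OF irr] by (intro dist_int_pos irrational_mult_nat irr)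
  ultimately show ?thesis using cf_qn_pos[OF irr, of k] by (simp add: field_simps)
qed

text \<open>
  The summand at \<open>n = q\<^sub>k\<close> is at least \<open>q\<^sub>k\<^sub>+\<^sub>1 / q\<^sub>k \<ge> a\<^sub>k\<^sub>+\<^sub>1\<close>. The denominators increase strictly except that
  \<open>q\<^sub>0 = q\<^sub>1 = 1\<close> if \<open>a\<^sub>1 = 1\<close>; in that case the single summand at \<open>n = 1\<close> pays for both partial
  quotients, since \<open>q\<^sub>2 / q\<^sub>1 = a\<^sub>2 + 1 = a\<^sub>1 + a\<^sub>2\<close>.
\<close>

lemma cf_A_le_S:
  assumes irr: "\<alpha> \<notin> \<rat>"
  shows "of_int (cf_A \<alpha> (Suc k)) \<le> S (cf_qn \<alpha> k) \<alpha>"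
proof (induction k)
  case 0
  have "of_int (cf_a \<alpha> 1) \<le> 1 / dist_int \<alpha>"
    using cf_term_ge[OF irr, of 0] cf_q_rec[OF irr] real_cf_qn[OF irr, of 1, symmetric]
    by (simp add: cf_qn_def)
  then show ?case by (simp add: cf_A_def S_def cf_qn_def cf_q_rec(1)[OF irr])
next
  case (Suc k)
  let ?q = "cf_qn \<alpha> k" and ?q' = "cf_qn \<alpha> (Suc k)" and ?q'' = "cf_qn \<alpha> (Suc (Suc k))"
  have rec: "real ?q'' = of_int (cf_a \<alpha> (Suc (Suc k))) * real ?q' + real ?q"
    using cf_q_rec(3)[OF irr, of k] by (simp add: real_cf_qn[OF irr, symmetric])
  have pos: "0 < ?q" "0 < ?q'" by (rule cf_qn_pos[OF irr])+
  have ratio: "real ?q'' / real ?q' = of_int (cf_a \<alpha> (Suc (Suc k))) + real ?q / real ?q'"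
    using pos by (simp add: rec field_simps)
  show ?case
  proof (cases "?q < ?q'")
    case True
    have "of_int (cf_A \<alpha> (Suc (Suc k))) = of_int (cf_A \<alpha> (Suc k)) + real_of_int (cf_a \<alpha> (Suc (Suc k)))"
      by (simp add: cf_A_Suc)
    also have "\<dots> \<le> S ?q \<alpha> + real ?q'' / real ?q'"
      using Suc divide_nonneg_nonneg[of "real ?q" "real ?q'"] unfolding ratio by linarith
    also have "\<dots> \<le> S ?q' \<alpha>"
      using S_add_le[OF True, of \<alpha>] cf_term_ge[OF irr, of "Suc k"] by linarith
    finally show ?thesis .
  next
    case False
    then have eq: "?q' = ?q" using cf_qn_le_Suc[OF irr, of k] by simp
    have k: "k = 0"
    proof (rule ccontr)
      assume "k \<noteq> 0"
      then obtain j where j: "k = Suc j" by (cases k) auto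
      have "1 * cf_q \<alpha> k \<le> cf_a \<alpha> (Suc k) * cf_q \<alpha> k"
        using cf_a_pos[OF irr] cf_q_ge_1[OF irr, of k] by (intro mult_right_mono) auto
      then have "cf_q \<alpha> k < cf_q \<alpha> (Suc k)"
        using cf_q_rec(3)[OF irr, of j] cf_q_ge_1[OF irr, of j] j by simp
      then show False using eq int_cf_qn[OF irr, of k] int_cf_qn[OF irr, of "Suc k"] by simp
    qed
    have q1: "?q' = 1" using eq k by (simp add: cf_qn_def cf_q_rec(1)[OF irr])
    then have "cf_a \<alpha> 1 = 1"
      using k cf_q_rec(2)[OF irr] int_cf_qn[OF irr, of "Suc k"] by simp
    then have "of_int (cf_A \<alpha> (Suc (Suc k))) = real ?q'' / real ?q'"
      using ratio eq pos k by (simp add: cf_A_def)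
    also have "\<dots> \<le> S ?q' \<alpha>"
      using cf_term_ge[OF irr, of "Suc k"] q1 by (simp add: S_def)
    finally show ?thesis .
  qed
qed

section \<open>Separated multiples in cells\<close>

lemma harm_le_ln:
  assumes "0 < n"
  shows "harm n \<le> 1 + ln (real n)"
  using euler_mascheroni_sequence_decreasing[of 1 n] assms by (simp add: harm_def)

lemma sum_inverse_squares_le: "(\<Sum>i=1..n. 1 / (real i)\<^sup>2) \<le> 2"
proof -
  have "(\<Sum>i=1..Suc m. 1 / (real i)\<^sup>2) \<le> 2 - 1 / real (Suc m)" for m
  proof (induction m)
    case (Suc m)
    have "1 / (real (Suc (Suc m)))\<^sup>2 \<le> 1 / real (Suc m) - 1 / real (Suc (Suc m))"
      by (simp add: divide_simps power2_eq_square)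
    then show ?case using Suc by simp
  qed simp
  then have "(\<Sum>i=1..Suc m. 1 / (real i)\<^sup>2) \<le> 2" for m
    by (rule order_trans) simp
  then show ?thesis by (cases n) simp_all
qed

lemma sum_le_sum_image:
  fixes f :: "'b \<Rightarrow> real"
  assumes "inj_on \<phi> A" "\<phi> ` A \<subseteq> T" "finite T" "\<And>t. t \<in> T \<Longrightarrow> 0 \<le> f t"
    "\<And>x. x \<in> A \<Longrightarrow> g x \<le> f (\<phi> x)"
  shows "sum g A \<le> sum f T"
proof -
  have "sum g A \<le> sum (f \<circ> \<phi>) A" using assms(5) by (intro sum_mono) simp
  also have "\<dots> = sum f (\<phi> ` A)" using assms(1) by (simp add: sum.reindex)
  also have "\<dots> \<le> sum f T" using assms(2-4) by (intro sum_mono2) auto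
  finally show ?thesis .
qed

definition above_nearest_int :: "real \<Rightarrow> nat \<Rightarrow> bool" where
  "above_nearest_int \<alpha> n \<longleftrightarrow> of_int (round (real n * \<alpha>)) < real n * \<alpha>"

text \<open>
  Any \<open>q\<close> consecutive multiples of \<open>\<alpha>\<close> then have pairwise distance at least \<open>1 / (2 q)\<close> on the circle.
\<close>

definition separated :: "real \<Rightarrow> nat \<Rightarrow> bool" where
  "separated \<alpha> q \<longleftrightarrow> (\<forall>n. 0 < n \<longrightarrow> n < q \<longrightarrow> 1 \<le> 2 * real q * dist_int (real n * \<alpha>))"

text \<open>
  The circle is cut, from \<open>0\<close> outwards in both directions, into arcs of length \<open>1 / (2 q)\<close>;
  \<open>cell\<close> numbers the arcs on each side.
\<close>

definition cell :: "real \<Rightarrow> nat \<Rightarrow> nat \<Rightarrow> nat" where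
  "cell \<alpha> q n = nat \<lfloor>2 * real q * dist_int (real n * \<alpha>)\<rfloor>"

lemma cell_le: "real (cell \<alpha> q n) \<le> 2 * real q * dist_int (real n * \<alpha>)"
  using dist_int_nonneg by (simp add: cell_def of_nat_floor)

lemma cell_le_q: "cell \<alpha> q n \<le> q"
proof -
  have "2 * real q * dist_int (real n * \<alpha>) \<le> 2 * real q * (1 / 2)"
    by (intro mult_left_mono dist_int_le_half) simp
  then show ?thesis using cell_le[of \<alpha> q n] by simp
qed

lemma cell_eq_0_iff: "cell \<alpha> q n = 0 \<longleftrightarrow> 2 * real q * dist_int (real n * \<alpha>) < 1"
  by (auto simp: cell_def floor_le_iff)

text \<open>
  Two multiples in the same arc on the same side of \<open>0\<close> are closer than \<open>1 / (2 q)\<close>, and their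
  difference is a multiple \<open>(m - n) \<alpha>\<close> that separation keeps away from the integers.
\<close>

lemma cell_distinct:
  assumes sep: "separated \<alpha> q" and "n < m" "m - n < q"
    and side: "above_nearest_int \<alpha> n = above_nearest_int \<alpha> m"
  shows "cell \<alpha> q n \<noteq> cell \<alpha> q m"
proof
  assume eq: "cell \<alpha> q n = cell \<alpha> q m"
  define x where "x = real n * \<alpha> - of_int (round (real n * \<alpha>))"
  define y where "y = real m * \<alpha> - of_int (round (real m * \<alpha>))"
  have "dist_int (real (m - n) * \<alpha>)
      \<le> \<bar>real (m - n) * \<alpha> - of_int (round (real m * \<alpha>) - round (real n * \<alpha>))\<bar>"
    by (rule dist_int_le)
  also have "real (m - n) * \<alpha> - of_int (round (real m * \<alpha>) - round (real n * \<alpha>)) = y - x"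
    using assms(2) by (simp add: x_def y_def of_nat_diff algebra_simps)
  also have "\<bar>y - x\<bar> = \<bar>\<bar>y\<bar> - \<bar>x\<bar>\<bar>"
    using side unfolding above_nearest_int_def x_def y_def by auto
  finally have "2 * real q * dist_int (real (m - n) * \<alpha>) \<le> 2 * real q * \<bar>\<bar>y\<bar> - \<bar>x\<bar>\<bar>"
    by (intro mult_left_mono) auto
  moreover have "1 \<le> 2 * real q * dist_int (real (m - n) * \<alpha>)"
    using sep assms(2,3) unfolding separated_def by (meson zero_less_diff)
  moreover have "2 * real q * \<bar>\<bar>y\<bar> - \<bar>x\<bar>\<bar> = \<bar>2 * real q * \<bar>y\<bar> - 2 * real q * \<bar>x\<bar>\<bar>"
    by (simp add: abs_mult right_diff_distrib[symmetric])
  moreover have "\<lfloor>2 * real q * \<bar>y\<bar>\<rfloor> = \<lfloor>2 * real q * \<bar>x\<bar>\<rfloor>"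
    using eq by (simp add: cell_def dist_int_def x_def y_def eq_nat_nat_iff)
  ultimately show False by linarith
qed

text \<open>
  The three encodings of indices used below, by side and quotient, by side and cell, and by all three,
  are injective by this criterion.
\<close>

lemma inj_on_cell:
  assumes "separated \<alpha> q" "\<And>n m. n \<in> A \<Longrightarrow> m \<in> A \<Longrightarrow> f n = f m \<Longrightarrow> n < m \<Longrightarrow> m - n < q"
    "\<And>n m. n \<in> A \<Longrightarrow> m \<in> A \<Longrightarrow> f n = f m
      \<Longrightarrow> above_nearest_int \<alpha> n = above_nearest_int \<alpha> m \<and> cell \<alpha> q n = cell \<alpha> q m"
  shows "inj_on f A"
proof (rule inj_onI)
  fix n m assume *: "n \<in> A" "m \<in> A" "f n = f m"
  show "n = m"
  proof (rule ccontr)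
    assume "n \<noteq> m"
    then consider "n < m" | "m < n" by linarith
    then show False
      using * assms(2)[of n m] assms(2)[of m n] assms(3)[of n m]
        cell_distinct[OF assms(1), of n m] cell_distinct[OF assms(1), of m n] by cases auto
  qed
qed

lemma diff_less_if_div_eq:
  fixes n m q :: nat
  assumes "n div q = m div q" "0 < q"
  shows "m - n < q"
proof -
  have "m = q * (n div q) + m mod q" "n = q * (n div q) + n mod q" "m mod q < q"
    using assms by (simp, metis mult_div_mod_eq, simp)
  then show ?thesis by linarith
qed

text \<open>
  Rounding down both \<open>n / q\<close> and \<open>2 r \<parallel>n \<alpha>\<parallel>\<close> to integers bounds a summand by a
  product of reciprocals of integers.
\<close>

lemma inverse_mult_dist_int_le:
  assumes irr: "\<alpha> \<notin> \<rat>" and "0 < q" "q \<le> n" "0 < cell \<alpha> r n"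
  shows "1 / (real n * dist_int (real n * \<alpha>))
     \<le> 2 * real r / (real q * real (n div q) * real (cell \<alpha> r n))"
proof -
  let ?m = "n div q" and ?j = "cell \<alpha> r n" and ?x = "dist_int (real n * \<alpha>)"
  have x: "0 < ?x" using assms by (intro dist_int_pos irrational_mult_nat) auto
  have m: "0 < ?m" using assms by (simp add: div_greater_zero_iff)
  have "q * ?m \<le> n" by simp
  then have "real q * real ?m \<le> real n" by (metis of_nat_le_iff of_nat_mult)
  then have "(real q * real ?m) * real ?j \<le> real n * (2 * real r * ?x)"
    by (intro mult_mono cell_le) auto
  then show ?thesis using x m assms by (simp add: field_simps)
qed

section \<open>The upper bound\<close>

text \<open>
  Here \<open>\<parallel>n \<alpha>\<parallel> \<ge> 1 / (2 q)\<close>. Indices with the same quotient \<open>n div q\<close> differ by less than \<open>q\<close>, so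
  the side, the quotient \<open>m\<close> and the cell \<open>j\<close> determine \<open>n\<close>, and the sum of \<open>2 / (m j)\<close> over all
  possible triples factors into harmonic numbers.
\<close>

lemma sum_far_le:
  assumes irr: "\<alpha> \<notin> \<rat>" and q: "0 < q" and sep: "separated \<alpha> q" and "R \<le> Suc M"
  shows "(\<Sum>n | n \<in> {q..<R} \<and> cell \<alpha> q n \<noteq> 0. 1 / (real n * dist_int (real n * \<alpha>)))
     \<le> 4 * harm (M div q) * harm q"
proof -
  let ?A = "{n. n \<in> {q..<R} \<and> cell \<alpha> q n \<noteq> 0}"
  let ?T = "(UNIV :: bool set) \<times> {1..M div q} \<times> {1..q}"
  define \<phi> where "\<phi> n = (above_nearest_int \<alpha> n, n div q, cell \<alpha> q n)" for n
  define f :: "bool \<times> nat \<times> nat \<Rightarrow> real" where "f = (\<lambda>(s, m, j). 2 / (real m * real j))"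
  have "(\<Sum>n\<in>?A. 1 / (real n * dist_int (real n * \<alpha>))) \<le> sum f ?T"
  proof (rule sum_le_sum_image)
    show "inj_on \<phi> ?A"
      by (rule inj_on_cell[OF sep]) (use q in \<open>auto simp: \<phi>_def intro: diff_less_if_div_eq\<close>)
    show "\<phi> ` ?A \<subseteq> ?T"
      using q assms(4) cell_le_q[of \<alpha> q]
      by (auto simp: \<phi>_def Suc_le_eq div_greater_zero_iff intro!: div_le_mono)
    show "1 / (real n * dist_int (real n * \<alpha>)) \<le> f (\<phi> n)" if "n \<in> ?A" for n
      using inverse_mult_dist_int_le[OF irr q, of n q] that q by (simp add: f_def \<phi>_def)
  qed (auto simp: f_def)
  also have "sum f ?T = (\<Sum>s\<in>(UNIV :: bool set). \<Sum>m=1..M div q. \<Sum>j=1..q. 2 / (real m * real j))"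
    by (simp add: f_def sum.cartesian_product[symmetric] del: sum_constant)
  also have "\<dots> = 4 * harm (M div q) * harm q"
    by (simp add: harm_def sum_product sum_distrib_left field_simps)
  finally show ?thesis .
qed

text \<open>
  Here \<open>\<parallel>n \<alpha>\<parallel> < 1 / (2 q)\<close>. On each side the quotient \<open>m = n div q\<close> alone determines \<open>n\<close>, by separation
  at scale \<open>q\<close>, and so does the cell \<open>j\<close> at the finer scale \<open>q'\<close>. The summand is at most
  \<open>2 q' / (q m j)\<close>; the inequality \<open>2 / (m j) \<le> 1 / m\<^sup>2 + 1 / j\<^sup>2\<close> decouples the two parameters, and each
  of the resulting sums of inverse squares converges.
\<close>

lemma sum_near_le:
  assumes irr: "\<alpha> \<notin> \<rat>" and q: "0 < q" and sep: "separated \<alpha> q"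
    and sep': "separated \<alpha> q'" and "R \<le> q'"
  shows "(\<Sum>n | n \<in> {q..<R} \<and> cell \<alpha> q n = 0. 1 / (real n * dist_int (real n * \<alpha>)))
     \<le> 8 * (real q' / real q)"
proof -
  let ?A = "{n. n \<in> {q..<R} \<and> cell \<alpha> q n = 0}"
  define f :: "bool \<times> nat \<Rightarrow> real" where "f = (\<lambda>(s, i). 1 / (real i)\<^sup>2)"
  have f: "sum f (UNIV \<times> {1..n}) \<le> 4" for n
  proof -
    have "sum f (UNIV \<times> {1..n}) = (\<Sum>s\<in>(UNIV :: bool set). \<Sum>i=1..n. 1 / (real i)\<^sup>2)"
      by (simp add: f_def sum.cartesian_product[symmetric] del: sum_constant)
    then show ?thesis using sum_inverse_squares_le[of n] by simp
  qed
  have cell': "0 < cell \<alpha> q' n" if "n \<in> ?A" for n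
  proof -
    have "0 < n" "n < q'" using that q assms(5) by auto
    then have "1 \<le> 2 * real q' * dist_int (real n * \<alpha>)" using sep' by (simp add: separated_def)
    then show ?thesis using cell_eq_0_iff[of \<alpha> q' n] by (meson gr0I not_less)
  qed
  have "(\<Sum>n\<in>?A. 1 / (real (n div q))\<^sup>2) \<le> sum f (UNIV \<times> {1..R div q})"
  proof (rule sum_le_sum_image[where \<phi> = "\<lambda>n. (above_nearest_int \<alpha> n, n div q)"])
    show "inj_on (\<lambda>n. (above_nearest_int \<alpha> n, n div q)) ?A"
      by (rule inj_on_cell[OF sep]) (use q in \<open>auto intro: diff_less_if_div_eq\<close>)
    show "(\<lambda>n. (above_nearest_int \<alpha> n, n div q)) ` ?A \<subseteq> UNIV \<times> {1..R div q}"
      using q by (auto simp: Suc_le_eq div_greater_zero_iff intro!: div_le_mono)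
  qed (auto simp: f_def)
  also note f
  finally have 1: "(\<Sum>n\<in>?A. 1 / (real (n div q))\<^sup>2) \<le> 4" .
  have "(\<Sum>n\<in>?A. 1 / (real (cell \<alpha> q' n))\<^sup>2) \<le> sum f (UNIV \<times> {1..q'})"
  proof (rule sum_le_sum_image[where \<phi> = "\<lambda>n. (above_nearest_int \<alpha> n, cell \<alpha> q' n)"])
    show "inj_on (\<lambda>n. (above_nearest_int \<alpha> n, cell \<alpha> q' n)) ?A"
      by (rule inj_on_cell[OF sep']) (use assms(5) in auto)
    show "(\<lambda>n. (above_nearest_int \<alpha> n, cell \<alpha> q' n)) ` ?A \<subseteq> UNIV \<times> {1..q'}"
    proof (rule image_subsetI)
      fix n assume "n \<in> ?A"
      then show "(above_nearest_int \<alpha> n, cell \<alpha> q' n) \<in> UNIV \<times> {1..q'}"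
        using cell'[of n] cell_le_q[of \<alpha> q' n] by simp
    qed
  qed (auto simp: f_def)
  also note f
  finally have 2: "(\<Sum>n\<in>?A. 1 / (real (cell \<alpha> q' n))\<^sup>2) \<le> 4" .
  have summand: "1 / (real n * dist_int (real n * \<alpha>))
      \<le> real q' / real q * (1 / (real (n div q))\<^sup>2 + 1 / (real (cell \<alpha> q' n))\<^sup>2)" if "n \<in> ?A" for n
  proof -
    define u v where "u = 1 / real (n div q)" and "v = 1 / real (cell \<alpha> q' n)"
    have "1 / (real n * dist_int (real n * \<alpha>)) \<le> real q' / real q * (2 * u * v)"
      using inverse_mult_dist_int_le[OF irr q _ cell'[OF that]] that
      by (simp add: u_def v_def mult_ac)
    also have "\<dots> \<le> real q' / real q * (u\<^sup>2 + v\<^sup>2)"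
      by (intro mult_left_mono sum_squares_bound) auto
    finally show ?thesis by (simp add: u_def v_def power_divide)
  qed
  have "(\<Sum>n\<in>?A. 1 / (real n * dist_int (real n * \<alpha>)))
      \<le> (\<Sum>n\<in>?A. real q' / real q * (1 / (real (n div q))\<^sup>2 + 1 / (real (cell \<alpha> q' n))\<^sup>2))"
    using summand by (rule sum_mono)
  also have "\<dots> = real q' / real q *
      ((\<Sum>n\<in>?A. 1 / (real (n div q))\<^sup>2) + (\<Sum>n\<in>?A. 1 / (real (cell \<alpha> q' n))\<^sup>2))"
    by (simp only: sum_distrib_left[symmetric] sum.distrib)
  also have "\<dots> \<le> real q' / real q * (4 + 4)"
    using 1 2 by (intro mult_left_mono add_mono) auto
  finally show ?thesis by (simp add: mult.commute)
qed

lemma sum_block_le: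
  assumes irr: "\<alpha> \<notin> \<rat>" and q: "0 < q" and sep: "separated \<alpha> q" "separated \<alpha> q'"
    and R: "R \<le> q'" "R \<le> Suc M"
  shows "(\<Sum>n=q..<R. 1 / (real n * dist_int (real n * \<alpha>)))
     \<le> 4 * harm (M div q) * harm q + 8 * (real q' / real q)"
proof -
  let ?g = "\<lambda>n. 1 / (real n * dist_int (real n * \<alpha>))"
  have "sum ?g {q..<R} = sum ?g {n. n \<in> {q..<R} \<and> cell \<alpha> q n \<noteq> 0}
      + sum ?g {n. n \<in> {q..<R} \<and> cell \<alpha> q n = 0}"
    by (subst sum.union_disjoint[symmetric]) (auto intro: sum.cong)
  also have "\<dots> \<le> 4 * harm (M div q) * harm q + 8 * (real q' / real q)"
    by (intro add_mono sum_far_le sum_near_le assms)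
  finally show ?thesis .
qed

lemma separated_cf_qn:
  assumes "\<alpha> \<notin> \<rat>"
  shows "separated \<alpha> (cf_qn \<alpha> k)"
  using dist_int_ge_below_cf_q[OF assms, of _ k]
  by (simp add: separated_def real_cf_qn[OF assms] int_cf_qn[OF assms, symmetric])

text \<open>
  The bound is stated for a prefix of the block between \<open>q\<^sub>k\<close> and \<open>q\<^sub>k\<^sub>+\<^sub>1\<close>, so that it covers the last block,
  which is cut off at \<open>N\<close>.
\<close>

lemma sum_cf_block_le:
  assumes irr: "\<alpha> \<notin> \<rat>" and R: "R \<le> cf_qn \<alpha> (Suc k)" "R \<le> Suc M" and M: "cf_qn \<alpha> k \<le> M"
  shows "(\<Sum>n=cf_qn \<alpha> k..<R. 1 / (real n * dist_int (real n * \<alpha>)))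
     \<le> 4 * (1 + ln (real (cf_qn \<alpha> k))) * (1 + ln (real M) - ln (real (cf_qn \<alpha> k)))
       + 8 * (of_int (cf_a \<alpha> (Suc k)) + 1)"
proof -
  let ?q = "cf_qn \<alpha> k" and ?q' = "cf_qn \<alpha> (Suc k)"
  have q: "0 < ?q" by (rule cf_qn_pos[OF irr])
  have "real_of_int (cf_q \<alpha> (Suc k)) \<le> of_int ((cf_a \<alpha> (Suc k) + 1) * cf_q \<alpha> k)"
    using cf_q_Suc_le[OF irr] by (simp only: of_int_le_iff)
  then have ratio: "real ?q' / real ?q \<le> of_int (cf_a \<alpha> (Suc k)) + 1"
    using q by (simp add: real_cf_qn[OF irr] pos_divide_le_eq)
  have "0 < M div ?q" using M q by (simp add: div_greater_zero_iff)
  then have "harm (M div ?q) \<le> 1 + ln (real (M div ?q))" by (rule harm_le_ln)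
  also have "ln (real (M div ?q)) \<le> ln (real M / real ?q)"
    using \<open>0 < M div ?q\<close> q M by (subst ln_le_cancel_iff) (auto simp: of_nat_div_le_of_nat)
  also have "\<dots> = ln (real M) - ln (real ?q)" using q M by (simp add: ln_div)
  finally have h: "harm (M div ?q) \<le> 1 + ln (real M) - ln (real ?q)" by simp
  have hh: "harm ?q * harm (M div ?q) \<le> (1 + ln (real ?q)) * (1 + ln (real M) - ln (real ?q))"
    using q by (intro mult_mono h harm_le_ln harm_nonneg) auto
  have "(\<Sum>n=?q..<R. 1 / (real n * dist_int (real n * \<alpha>)))
      \<le> 4 * (harm ?q * harm (M div ?q)) + 8 * (real ?q' / real ?q)"
    using sum_block_le[OF irr q separated_cf_qn[OF irr] separated_cf_qn[OF irr] R]
    by (simp only: mult_ac)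
  also have "\<dots> \<le> 4 * ((1 + ln (real ?q)) * (1 + ln (real M) - ln (real ?q)))
      + 8 * (of_int (cf_a \<alpha> (Suc k)) + 1)"
    using hh ratio by (intro add_mono mult_left_mono) auto
  finally show ?thesis by (simp only: mult.assoc)
qed

text \<open>
  The far part of each block contributes \<open>ln q\<^sub>k\<^sub>+\<^sub>1 - ln q\<^sub>k + 1\<close> times a slowly growing factor. Bounding that factor by
  its final value makes the differences telescope, so that only two logarithms are multiplied.
\<close>

lemma sum_below_cf_qn_le:
  assumes irr: "\<alpha> \<notin> \<rat>"
  shows "(\<Sum>n=1..<cf_qn \<alpha> k. 1 / (real n * dist_int (real n * \<alpha>)))
     \<le> 4 * (1 + ln (real (cf_qn \<alpha> k))) * (real k + ln (real (cf_qn \<alpha> k)))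
       + 8 * (of_int (cf_A \<alpha> k) + real k)"
proof (induction k)
  case 0
  then show ?case by (simp add: cf_qn_def cf_q_rec(1)[OF irr] cf_A_def)
next
  case (Suc k)
  let ?q = "cf_qn \<alpha> k" and ?q' = "cf_qn \<alpha> (Suc k)"
  let ?g = "\<lambda>n. 1 / (real n * dist_int (real n * \<alpha>))"
  have q: "0 < ?q" "?q \<le> ?q'" using cf_qn_pos[OF irr] cf_qn_le_Suc[OF irr] by auto
  have ln: "0 \<le> ln (real ?q)" "ln (real ?q) \<le> ln (real ?q')" using q by auto
  have "sum ?g {1..<?q'} = sum ?g {1..<?q} + sum ?g {?q..<?q'}"
    using q by (intro sum.atLeastLessThan_concat[symmetric]) auto
  also have "\<dots> \<le> (4 * (1 + ln (real ?q)) * (real k + ln (real ?q)) + 8 * (of_int (cf_A \<alpha> k) + real k))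
     + (4 * (1 + ln (real ?q)) * (1 + ln (real ?q') - ln (real ?q)) + 8 * (of_int (cf_a \<alpha> (Suc k)) + 1))"
    using q by (intro add_mono Suc sum_cf_block_le irr) auto
  also have "\<dots> = 4 * ((1 + ln (real ?q)) * (real (Suc k) + ln (real ?q')))
      + 8 * (of_int (cf_A \<alpha> (Suc k)) + real (Suc k))"
    by (simp add: cf_A_Suc algebra_simps)
  also have "(1 + ln (real ?q)) * (real (Suc k) + ln (real ?q'))
      \<le> (1 + ln (real ?q')) * (real (Suc k) + ln (real ?q'))"
    using ln by (intro mult_right_mono) auto
  finally show ?case by (simp only: mult.assoc)
qed

lemma S_le:
  assumes irr: "\<alpha> \<notin> \<rat>" and N: "1 \<le> N"
  defines "K \<equiv> cf_K N \<alpha>"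
  shows "S N \<alpha> \<le> 4 * (1 + ln (real N)) * (real (K + 1) + ln (real N))
     + 8 * (of_int (cf_A \<alpha> (K + 1)) + real (K + 1))"
proof -
  let ?q = "cf_qn \<alpha> K" and ?q' = "cf_qn \<alpha> (Suc K)"
  let ?g = "\<lambda>n. 1 / (real n * dist_int (real n * \<alpha>))"
  have q: "0 < ?q" by (rule cf_qn_pos[OF irr])
  have "?q \<le> N" using cf_K(1)[OF irr N] by (simp add: K_def cf_qn_def)
  have "\<not> cf_q \<alpha> (Suc K) \<le> int N" using cf_K(2)[OF irr N, of "Suc K"] by (auto simp: K_def)
  then have "Suc N \<le> ?q'" using int_cf_qn[OF irr, of "Suc K"] by linarith
  have ln: "0 \<le> ln (real ?q)" "ln (real ?q) \<le> ln (real N)" using q \<open>?q \<le> N\<close> by auto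
  have "S N \<alpha> = sum ?g {1..<Suc N}"
    by (simp add: S_def atLeastLessThanSuc_atLeastAtMost)
  also have "\<dots> = sum ?g {1..<?q} + sum ?g {?q..<Suc N}"
    using q \<open>?q \<le> N\<close> by (intro sum.atLeastLessThan_concat[symmetric]) auto
  also have "\<dots> \<le> (4 * (1 + ln (real ?q)) * (real K + ln (real ?q)) + 8 * (of_int (cf_A \<alpha> K) + real K))
     + (4 * (1 + ln (real ?q)) * (1 + ln (real N) - ln (real ?q)) + 8 * (of_int (cf_a \<alpha> (Suc K)) + 1))"
    using \<open>?q \<le> N\<close> \<open>Suc N \<le> ?q'\<close> by (intro add_mono sum_below_cf_qn_le sum_cf_block_le irr) auto
  also have "\<dots> = 4 * ((1 + ln (real ?q)) * (real (K + 1) + ln (real N)))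
      + 8 * (of_int (cf_A \<alpha> (K + 1)) + real (K + 1))"
    by (simp add: cf_A_Suc algebra_simps)
  also have "(1 + ln (real ?q)) * (real (K + 1) + ln (real N))
      \<le> (1 + ln (real N)) * (real (K + 1) + ln (real N))"
    using ln by (intro mult_right_mono) auto
  finally show ?thesis by (simp only: mult.assoc)
qed

theorem theorem1p1:
  fixes \<alpha> :: real
  assumes "\<alpha> \<notin> \<rat>"
  shows "\<forall>\<^sub>F N in sequentially.
           max (1 / 2 * (ln (real N))\<^sup>2) (real_of_int (cf_A \<alpha> (cf_K N \<alpha> + 1))) \<le> S N \<alpha> \<and>
           S N \<alpha> \<le> 33 * (ln (real N))\<^sup>2 + 10 * real_of_int (cf_A \<alpha> (cf_K N \<alpha> + 1))"
proof -
  have "\<forall>\<^sub>F N in sequentially. 4 \<le> ln (real N)"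
    using filterlim_compose[OF ln_at_top filterlim_real_sequentially] by (simp add: filterlim_at_top)
  with eventually_ge_at_top[of 1] show ?thesis
  proof eventually_elim
    case (elim N)
    let ?K = "cf_K N \<alpha>" and ?L = "ln (real N)"
    let ?A = "real_of_int (cf_A \<alpha> (?K + 1))"
    have "?A \<le> S (cf_qn \<alpha> ?K) \<alpha>" using cf_A_le_S[OF assms, of ?K] by simp
    also have "\<dots> \<le> S N \<alpha>"
      using cf_K(1)[OF assms elim(1)] by (intro S_mono) (simp add: cf_qn_def)
    finally have A: "?A \<le> S N \<alpha>" .
    have "0 \<le> ?A"
      unfolding cf_A_def using cf_a_pos[OF assms]
      by (intro of_int_nonneg sum_nonneg) (metis Suc_le_D One_nat_def atLeastAtMost_iff order_trans zero_le_one)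
    have K: "real (?K + 1) \<le> 2 + 3 * ?L" using cf_K_le_ln[OF assms elim(1)] by simp
    have "4 * ?L \<le> ?L * ?L" using elim(2) by (intro mult_right_mono) auto
    have "S N \<alpha> \<le> 4 * (1 + ?L) * (real (?K + 1) + ?L) + 8 * (?A + real (?K + 1))"
      by (rule S_le[OF assms elim(1)])
    also have "\<dots> \<le> 4 * (1 + ?L) * ((2 + 3 * ?L) + ?L) + 8 * (?A + (2 + 3 * ?L))"
      using K elim(2) by (intro add_mono mult_left_mono) auto
    also have "\<dots> = 16 * (?L * ?L) + 48 * ?L + 24 + 8 * ?A" by (simp add: algebra_simps)
    also have "\<dots> \<le> 33 * ?L\<^sup>2 + 10 * ?A"
      using \<open>0 \<le> ?A\<close> \<open>4 * ?L \<le> ?L * ?L\<close> elim(2) unfolding power2_eq_square by linarith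
    finally show ?case using A S_ge_ln[OF assms elim] by simp
  qed
qed

end
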